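(* For all programs $C$ and all $[(f,g)]_{\approx},[(f',g')]_{\approx}\in\mathbb{IE}$: if $[(f,g)]_{\approx}\sqsubseteq[(f',g')]_{\approx}$ then $\widetilde{\mathsf{wp}}[C]\,[(f,g)]_{\approx}\sqsubseteq\widetilde{\mathsf{wp}}[C]\,[(f',g')]_{\approx}$.
   Context: Programs: $C::=\mathtt{skip}\mid x:=E\mid C;C\mid \mathtt{if}(\xi)\{C\}\mathtt{else}\{C\}\mid\mathtt{while}(\xi)\{C\}$ over states $\Sigma$, with probabilistic guards $\xi$ interpreted as $p_\xi:\Sigma\to[0,1]$. $\mathbb{E}^{\star}=\{\Sigma\to\mathbb R\}$, $\mathbb{E}_{\geq0}^{\infty}=\{\Sigma\to[0,\infty]\}$, $\mathbb P=\{(f,g)\mid f\in\mathbb{E}^{\star},g\in\mathbb{E}_{\geq0}^{\infty},|f|\le g\}$. Quasi-order: $(f,g)\precsim(f',g')$ iff for all $\sigma$, $g'(\sigma)\neq\infty$ implies $f(\sigma)\le f'(\sigma)$ and $g(\sigma)\le g'(\sigma)$; $\approx\,=\,\precsim\cap\succsim$; $[(f,g)]_\approx$ is the equivalence class, $\mathbb{IE}$ the set of classes, and $[(f,g)]_\approx\sqsubseteq[(f',g')]_\approx$ iff $(f,g)\precsim(f',g')$. Operations $(f,g)+(f',g')=(f+f',g+g')$, $c\cdot(f,g)=(cf,|c|g)$, $h\cdot(f,g)=(hf,|h|g)$, lifted to classes. $\widetilde{\mathsf{wp}}[C]:\mathbb{IE}\to\mathbb{IE}$: skip identity; $x:=E$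 substitutes $E$ for $x$ in both components; $C_1;C_2$ composes; if-then-else gives $p_\xi\cdot\widetilde{\mathsf{wp}}[C_1][(f,g)]_\approx+(1-p_\xi)\cdot\widetilde{\mathsf{wp}}[C_2][(f,g)]_\approx$; $\widetilde{\mathsf{wp}}[\mathtt{while}(\xi)\{C'\}][(f,g)]_\approx=\lim_{n\to\omega}\Psi^n([(\mathbf0,\mathbf0)]_\approx)$ with $\Psi([(X,Y)]_\approx)=(1-p_\xi)\cdot[(f,g)]_\approx+p_\xi\cdot\widetilde{\mathsf{wp}}[C'][(X,Y)]_\approx$ (limits taken pointwise on representatives; this limit always exists and is unique). *)

theory Defs
  imports "HOL-Library.Extended_Nonnegative_Real"
begin

section \<open>Programs\<close>

text \<open>
  States are functions from variables to values, for arbitrary types of variables and values.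
  Expressions and probabilistic guards are represented by their meaning: an expression is a
  function from states to values, and a guard \<open>\<xi>\<close> is its interpretation \<open>p\<^sub>\<xi>\<close>, the
  probability that \<open>\<xi>\<close> evaluates to true.
\<close>

type_synonym ('v, 'a) state = "'v \<Rightarrow> 'a"

typedef 's guard = "{p :: 's \<Rightarrow> real. \<forall>\<sigma>. 0 \<le> p \<sigma> \<and> p \<sigma> \<le> 1}"
  morphisms prob Guard
  by (rule exI[of _ "\<lambda>_. 0"]) simp

datatype ('v, 'a) prog =
    Skip
  | Assign 'v "('v, 'a) state \<Rightarrow> 'a"
  | Seq "('v, 'a) prog" "('v, 'a) prog"
  | If "('v, 'a) state guard" "('v, 'a) prog" "('v, 'a) prog"
  | While "('v, 'a) state guard" "('v, 'a) prog"


section \<open>Integrability-witnessing pairs\<close>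

typedef 's iwp = "{(f :: 's \<Rightarrow> real, g :: 's \<Rightarrow> ennreal). \<forall>\<sigma>. ennreal \<bar>f \<sigma>\<bar> \<le> g \<sigma>}"
  by (rule exI[of _ "(\<lambda>_. 0, \<lambda>_. 0)"]) simp

setup_lifting type_definition_iwp

lift_definition integrand :: "'s iwp \<Rightarrow> 's \<Rightarrow> real" is fst .

lift_definition witness :: "'s iwp \<Rightarrow> 's \<Rightarrow> ennreal" is snd .

lift_definition zero_iwp :: "'s iwp" is "(\<lambda>_. 0, \<lambda>_. 0)"
  by simp

lift_definition plus_iwp :: "'s iwp \<Rightarrow> 's iwp \<Rightarrow> 's iwp" is
  "\<lambda>(f, g) (f', g'). (\<lambda>\<sigma>. f \<sigma> + f' \<sigma>, \<lambda>\<sigma>. g \<sigma> + g' \<sigma>)"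
proof clarsimp
  fix f f' :: "'s \<Rightarrow> real" and g g' :: "'s \<Rightarrow> ennreal" and \<sigma>
  assume a: "\<forall>\<sigma>. ennreal \<bar>f \<sigma>\<bar> \<le> g \<sigma>" "\<forall>\<sigma>. ennreal \<bar>f' \<sigma>\<bar> \<le> g' \<sigma>"
  have "ennreal \<bar>f \<sigma> + f' \<sigma>\<bar> \<le> ennreal (\<bar>f \<sigma>\<bar> + \<bar>f' \<sigma>\<bar>)"
    by (intro ennreal_leI) simp
  also have "\<dots> = ennreal \<bar>f \<sigma>\<bar> + ennreal \<bar>f' \<sigma>\<bar>"
    by simp
  also have "\<dots> \<le> g \<sigma> + g' \<sigma>"
    using a by (intro add_mono) auto
  finally show "ennreal \<bar>f \<sigma> + f' \<sigma>\<bar> \<le> g \<sigma> + g' \<sigma>" .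
qed

text \<open>On \<^typ>\<open>ennreal\<close> we have \<open>0 \<cdot> \<infinity> = 0\<close>, as usual for expectations.\<close>

lift_definition scale_iwp :: "('s \<Rightarrow> real) \<Rightarrow> 's iwp \<Rightarrow> 's iwp" is
  "\<lambda>h (f, g). (\<lambda>\<sigma>. h \<sigma> * f \<sigma>, \<lambda>\<sigma>. ennreal \<bar>h \<sigma>\<bar> * g \<sigma>)"
  by (auto simp: abs_mult ennreal_mult intro!: mult_left_mono)

lift_definition subst_iwp ::
  "'v \<Rightarrow> (('v, 'a) state \<Rightarrow> 'a) \<Rightarrow> ('v, 'a) state iwp \<Rightarrow> ('v, 'a) state iwp" is
  "\<lambda>x E (f, g). (\<lambda>\<sigma>. f (\<sigma>(x := E \<sigma>)), \<lambda>\<sigma>. g (\<sigma>(x := E \<sigma>)))"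
  by auto

definition iwp_le :: "'s iwp \<Rightarrow> 's iwp \<Rightarrow> bool"  (infix \<open>\<precsim>\<close> 50) where
  "F \<precsim> F' \<longleftrightarrow>
     (\<forall>\<sigma>. witness F' \<sigma> \<noteq> \<infinity> \<longrightarrow>
        integrand F \<sigma> \<le> integrand F' \<sigma> \<and> witness F \<sigma> \<le> witness F' \<sigma>)"

definition iwp_eq :: "'s iwp \<Rightarrow> 's iwp \<Rightarrow> bool"  (infix \<open>\<approx>\<^sub>I\<close> 50) where
  "F \<approx>\<^sub>I F' \<longleftrightarrow> F \<precsim> F' \<and> F' \<precsim> F"

text \<open>
  Pointwise convergence. Where the limit of the witnesses is \<open>\<infinity>\<close>, nothing is required of the
  integrands: there they need not converge in the reals, and the value of the integrand of the
  limit is irrelevant up to \<open>\<approx>\<^sub>I\<close>.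
\<close>

definition iwp_tendsto :: "(nat \<Rightarrow> 's iwp) \<Rightarrow> 's iwp \<Rightarrow> bool" where
  "iwp_tendsto F L \<longleftrightarrow>
     (\<forall>\<sigma>. (\<lambda>n. witness (F n) \<sigma>) \<longlonglongrightarrow> witness L \<sigma> \<and>
          (witness L \<sigma> \<noteq> \<infinity> \<longrightarrow> (\<lambda>n. integrand (F n) \<sigma>) \<longlonglongrightarrow> integrand L \<sigma>))"

lemma iwp_le_refl: "F \<precsim> F"
  by (simp add: iwp_le_def)

lemma iwp_le_trans: "F \<precsim> G \<Longrightarrow> G \<precsim> H \<Longrightarrow> F \<precsim> H"
  unfolding iwp_le_def by (metis infinity_ennreal_def order_trans top.extremum_uniqueI)

lemma iwp_eq_iff:
  "F \<approx>\<^sub>I F' \<longleftrightarrow>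
     (\<forall>\<sigma>. witness F \<sigma> = witness F' \<sigma> \<and>
          (witness F \<sigma> \<noteq> \<infinity> \<longrightarrow> integrand F \<sigma> = integrand F' \<sigma>))"
  unfolding iwp_eq_def iwp_le_def
  by (metis infinity_ennreal_def order.antisym order.refl top.extremum_uniqueI)

lemma equivp_iwp_eq: "equivp iwp_eq"
  by (rule equivpI) (auto simp: reflp_def symp_def transp_def iwp_eq_iff)

lemma integrand_simps [simp]:
  "integrand zero_iwp \<sigma> = 0"
  "integrand (plus_iwp F G) \<sigma> = integrand F \<sigma> + integrand G \<sigma>"
  "integrand (scale_iwp h F) \<sigma> = h \<sigma> * integrand F \<sigma>"
  by (transfer; auto)+

lemma witness_simps [simp]:
  "witness zero_iwp \<sigma> = 0"
  "witness (plus_iwp F G) \<sigma> = witness F \<sigma> + witness G \<sigma>"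
  "witness (scale_iwp h F) \<sigma> = ennreal \<bar>h \<sigma>\<bar> * witness F \<sigma>"
  by (transfer; auto)+

lemma subst_iwp_simps [simp]:
  "integrand (subst_iwp x E K) \<tau> = integrand K (\<tau>(x := E \<tau>))"
  "witness (subst_iwp x E K) \<tau> = witness K (\<tau>(x := E \<tau>))"
  by (transfer; auto)+


section \<open>Integrability-witnessing expectations\<close>

quotient_type 's ie = "'s iwp" / iwp_eq
  by (rule equivp_iwp_eq)

text \<open>The partial order \<open>\<sqsubseteq>\<close> on equivalence classes is written \<open>\<le>\<close>.\<close>

instantiation ie :: (type) order
begin

lift_definition less_eq_ie :: "'s ie \<Rightarrow> 's ie \<Rightarrow> bool" is iwp_le
  unfolding iwp_eq_def by (blast intro: iwp_le_trans)

definition less_ie :: "'s ie \<Rightarrow> 's ie \<Rightarrow> bool" where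
  "less_ie X Y \<longleftrightarrow> X \<le> Y \<and> \<not> Y \<le> X"

instance
proof
  fix X Y Z :: "'a ie"
  show "(X < Y) = (X \<le> Y \<and> \<not> Y \<le> X)"
    by (rule less_ie_def)
  show "X \<le> X"
    by transfer (rule iwp_le_refl)
  show "X \<le> Y \<Longrightarrow> Y \<le> Z \<Longrightarrow> X \<le> Z"
    by transfer (rule iwp_le_trans)
  show "X \<le> Y \<Longrightarrow> Y \<le> X \<Longrightarrow> X = Y"
    by transfer (simp add: iwp_eq_def)
qed

end

instantiation ie :: (type) "{zero, plus}"
begin

lift_definition zero_ie :: "'s ie" is zero_iwp .

lift_definition plus_ie :: "'s ie \<Rightarrow> 's ie \<Rightarrow> 's ie" is plus_iwp
  by (auto simp: iwp_eq_iff)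

instance ..

end

lift_definition scale_ie :: "('s \<Rightarrow> real) \<Rightarrow> 's ie \<Rightarrow> 's ie"  (infixr \<open>\<odot>\<close> 75) is scale_iwp
  by (fastforce simp: iwp_eq_iff ennreal_mult_eq_top_iff)

lift_definition subst_ie ::
  "'v \<Rightarrow> (('v, 'a) state \<Rightarrow> 'a) \<Rightarrow> ('v, 'a) state ie \<Rightarrow> ('v, 'a) state ie" is subst_iwp
  by (simp add: iwp_eq_iff)

text \<open>Convergence does not depend on the choice of representatives.\<close>

lemma iwp_tendsto_cong:
  assumes "\<And>n. F n \<approx>\<^sub>I F' n" and "L \<approx>\<^sub>I L'" and "iwp_tendsto F L"
  shows "iwp_tendsto F' L'"
  unfolding iwp_tendsto_def
proof (intro allI conjI impI)
  fix \<sigma>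
  have w: "(\<lambda>n. witness (F n) \<sigma>) \<longlonglongrightarrow> witness L \<sigma>"
    using assms(3) by (simp add: iwp_tendsto_def)
  show "(\<lambda>n. witness (F' n) \<sigma>) \<longlonglongrightarrow> witness L' \<sigma>"
    using w assms(1,2) by (simp add: iwp_eq_iff)
  assume fin: "witness L' \<sigma> \<noteq> \<infinity>"
  then have finL: "witness L \<sigma> \<noteq> \<infinity>"
    using assms(2) by (simp add: iwp_eq_iff)
  then have "\<forall>\<^sub>F n in sequentially. witness (F n) \<sigma> < \<infinity>"
    using w by (intro order_tendstoD(2)[OF w]) (simp add: less_top)
  then have "\<forall>\<^sub>F n in sequentially. integrand (F n) \<sigma> = integrand (F' n) \<sigma>"
    by eventually_elim (use assms(1) in \<open>auto simp: iwp_eq_iff\<close>)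
  moreover have "(\<lambda>n. integrand (F n) \<sigma>) \<longlonglongrightarrow> integrand L' \<sigma>"
    using assms(2,3) finL by (simp add: iwp_tendsto_def iwp_eq_iff)
  ultimately show "(\<lambda>n. integrand (F' n) \<sigma>) \<longlonglongrightarrow> integrand L' \<sigma>"
    by (rule Lim_transform_eventually[rotated])
qed

lift_definition ie_tendsto :: "(nat \<Rightarrow> 's ie) \<Rightarrow> 's ie \<Rightarrow> bool" is iwp_tendsto
  by (rule iffI; erule iwp_tendsto_cong[rotated 2]) (auto simp: rel_fun_def iwp_eq_def)

lemma ie_tendsto_unique: "ie_tendsto S X \<Longrightarrow> ie_tendsto S Y \<Longrightarrow> X = Y"
  by transfer (simp add: iwp_tendsto_def iwp_eq_iff, metis LIMSEQ_unique)

definition ie_lim :: "(nat \<Rightarrow> 's ie) \<Rightarrow> 's ie" where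
  "ie_lim S = (THE L. ie_tendsto S L)"

lemma ie_lim_eq: "ie_tendsto S L \<Longrightarrow> ie_lim S = L"
  unfolding ie_lim_def by (blast intro: ie_tendsto_unique)


section \<open>Weakest pre-expectations\<close>

primrec wp :: "('v, 'a) prog \<Rightarrow> ('v, 'a) state ie \<Rightarrow> ('v, 'a) state ie" where
  "wp Skip X = X"
| "wp (Assign x E) X = subst_ie x E X"
| "wp (Seq C\<^sub>1 C\<^sub>2) X = wp C\<^sub>1 (wp C\<^sub>2 X)"
| "wp (If \<xi> C\<^sub>1 C\<^sub>2) X = prob \<xi> \<odot> wp C\<^sub>1 X + (\<lambda>\<sigma>. 1 - prob \<xi> \<sigma>) \<odot> wp C\<^sub>2 X"
| "wp (While \<xi> C) X =
     ie_lim (\<lambda>n. ((\<lambda>Y. (\<lambda>\<sigma>. 1 - prob \<xi> \<sigma>) \<odot> X + prob \<xi> \<odot> wp C Y) ^^ n) 0)"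

end

theory Submission
  imports Defs
begin

text \<open>
  Write \<open>\<Psi> Y = A + T Y\<close> for the characteristic function of a loop. By induction on programs,
  \<open>wp\<close> is additive and preserves \<open>0\<close>, hence so does \<open>T\<close>, and
  \<open>\<Psi>\<^sup>n\<^sup>+\<^sup>1 0 = \<Psi>\<^sup>n 0 + T\<^sup>n A\<close>. The iterates are thus partial sums of a series: the witnesses always
  converge in \<open>[0, \<infinity>]\<close>, and where their limit is finite they dominate the integrands, whose series
  converges absolutely. So the limit exists, and both additivity and monotonicity pass to it.
\<close>

instance ie :: (type) comm_monoid_add
proof
  fix X Y Z :: "'a ie"
  show "X + Y + Z = X + (Y + Z)"
    by transfer (simp add: iwp_eq_iff add.assoc)
  show "X + Y = Y + X"
    by transfer (simp add: iwp_eq_iff add.commute)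
  show "0 + X = X"
    by transfer (simp add: iwp_eq_iff)
qed

text \<open>The order says nothing at states where the witness of \<open>G\<close> is infinite, but
  there the bound is trivial.\<close>

lemma iwp_le_witness: "F \<precsim> G \<Longrightarrow> witness F \<sigma> \<le> witness G \<sigma>"
  unfolding iwp_le_def by (metis infinity_ennreal_def top_greatest)

lemma ie_add_mono:
  fixes X X' Y Y' :: "'s ie"
  shows "X \<le> X' \<Longrightarrow> Y \<le> Y' \<Longrightarrow> X + Y \<le> X' + Y'"
  by transfer (auto simp: iwp_le_def intro!: add_mono)

text \<open>The delicate states have \<open>h \<sigma> = 0\<close> and an infinite witness of
  \<open>X'\<close>: scaling makes the witness finite where the order left the integrands unrelated.
  Both scaled integrands are 0 there.\<close>

lemma scale_ie_mono:
  assumes "\<And>\<sigma>. 0 \<le> h \<sigma>" and "X \<le> X'"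
  shows "h \<odot> X \<le> h \<odot> X'"
  using assms
proof transfer
  fix h :: "'a \<Rightarrow> real" and F F' :: "'a iwp"
  assume h: "\<And>\<sigma>. 0 \<le> h \<sigma>" and le: "F \<precsim> F'"
  have "h \<sigma> * integrand F \<sigma> \<le> h \<sigma> * integrand F' \<sigma>"
    if "ennreal \<bar>h \<sigma>\<bar> * witness F' \<sigma> \<noteq> \<infinity>" for \<sigma>
  proof (cases "h \<sigma> = 0")
    case False
    with that have "witness F' \<sigma> \<noteq> \<infinity>"
      by (auto simp: ennreal_mult_eq_top_iff)
    with le h show ?thesis
      by (simp add: iwp_le_def mult_left_mono)
  qed simp
  then show "scale_iwp h F \<precsim> scale_iwp h F'"
    using iwp_le_witness[OF le] by (auto simp: iwp_le_def intro: mult_left_mono)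
qed

lemma scale_ie_add: "h \<odot> (X + Y) = h \<odot> X + h \<odot> Y"
  by transfer (simp add: iwp_eq_iff distrib_left)

lemma scale_ie_zero: "h \<odot> 0 = 0"
  by transfer (simp add: iwp_eq_iff)

lemma subst_ie_mono: "X \<le> X' \<Longrightarrow> subst_ie x E X \<le> subst_ie x E X'"
  by transfer (simp add: iwp_le_def)

lemma subst_ie_add: "subst_ie x E (X + Y) = subst_ie x E X + subst_ie x E Y"
  by transfer (simp add: iwp_eq_iff)

lemma subst_ie_zero: "subst_ie x E 0 = 0"
  by transfer (simp add: iwp_eq_iff)

lemma ie_tendsto_const: "ie_tendsto (\<lambda>_. X) X"
  by transfer (simp add: iwp_tendsto_def)

lemma ie_tendsto_add:
  assumes "ie_tendsto S X" and "ie_tendsto T Y"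
  shows "ie_tendsto (\<lambda>n. S n + T n) (X + Y)"
  using assms by transfer (auto simp: iwp_tendsto_def intro!: tendsto_add)

lemma ie_tendsto_le:
  assumes "ie_tendsto S X" and "ie_tendsto T Y" and "\<And>n. S n \<le> T n"
  shows "X \<le> Y"
  using assms
proof transfer
  fix F G :: "nat \<Rightarrow> 'a iwp" and K L
  assume F: "iwp_tendsto F K" and G: "iwp_tendsto G L" and le: "\<And>n. F n \<precsim> G n"
  show "K \<precsim> L"
    unfolding iwp_le_def
  proof (intro allI impI)
    fix \<sigma>
    assume fin: "witness L \<sigma> \<noteq> \<infinity>"
    have wF: "(\<lambda>n. witness (F n) \<sigma>) \<longlonglongrightarrow> witness K \<sigma>"
      and wG: "(\<lambda>n. witness (G n) \<sigma>) \<longlonglongrightarrow> witness L \<sigma>"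
      using F G by (auto simp: iwp_tendsto_def)
    have w: "witness K \<sigma> \<le> witness L \<sigma>"
      using wF wG by (rule LIMSEQ_le) (auto intro: iwp_le_witness le)
    with fin have finK: "witness K \<sigma> \<noteq> \<infinity>"
      by (auto simp: top_unique)
    \<comment> \<open>Single members of \<open>G\<close> may still have an infinite witness at this
      state, so the integrands are compared only from some index on, which suffices for the
      limits.\<close>
    have "\<forall>\<^sub>F n in sequentially. witness (G n) \<sigma> < \<infinity>"
      using fin by (intro order_tendstoD(2)[OF wG]) (simp add: less_top)
    then have "\<forall>\<^sub>F n in sequentially. integrand (F n) \<sigma> \<le> integrand (G n) \<sigma>"
      by eventually_elim (use le in \<open>auto simp: iwp_le_def\<close>)
    moreover have "(\<lambda>n. integrand (F n) \<sigma>) \<longlonglongrightarrow> integrand K \<sigma>"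
      and "(\<lambda>n. integrand (G n) \<sigma>) \<longlonglongrightarrow> integrand L \<sigma>"
      using F G fin finK by (auto simp: iwp_tendsto_def)
    ultimately have "integrand K \<sigma> \<le> integrand L \<sigma>"
      by (intro tendsto_le[OF sequentially_bot])
    with w show "integrand K \<sigma> \<le> integrand L \<sigma> \<and> witness K \<sigma> \<le> witness L \<sigma>"
      by simp
  qed
qed

lemma abs_integrand_le_witness: "ennreal \<bar>integrand F \<sigma>\<bar> \<le> witness F \<sigma>"
  by transfer auto

lemma iwp_exists:
  assumes "\<And>\<sigma>. ennreal \<bar>f \<sigma>\<bar> \<le> g \<sigma>"
  obtains F where "integrand F = f" and "witness F = g"
proof
  show "integrand (Abs_iwp (f, g)) = f" and "witness (Abs_iwp (f, g)) = g"
    using assms by (simp_all add: integrand.rep_eq witness.rep_eq Abs_iwp_inverse)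
qed

text \<open>The hypotheses hold only up to \<open>\<approx>\<^sub>I\<close>, so that the result
  transfers to equivalence classes. \<open>D\<close> collects the increments, and the limit is their
  sum in both components.\<close>

lemma iwp_series_tendsto:
  assumes "F 0 \<approx>\<^sub>I zero_iwp" and "\<And>n. F (Suc n) \<approx>\<^sub>I plus_iwp (F n) (D n)"
  shows "\<exists>L. iwp_tendsto F L"
proof -
  define g where "g \<sigma> = (\<Sum>k. witness (D k) \<sigma>)" for \<sigma>
  \<comment> \<open>Where \<open>g\<close> is infinite the integrand series may diverge; convergence
    asks nothing there, and 0 is an arbitrary choice.\<close>
  define f where "f \<sigma> = (if g \<sigma> = \<infinity> then 0 else \<Sum>k. integrand (D k) \<sigma>)" for \<sigma>
  have wF: "witness (F n) \<sigma> = (\<Sum>k<n. witness (D k) \<sigma>)" for n \<sigma>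
    using assms by (induction n) (auto simp: iwp_eq_iff)
  have iF: "integrand (F n) \<sigma> = (\<Sum>k<n. integrand (D k) \<sigma>)" if "g \<sigma> \<noteq> \<infinity>" for n \<sigma>
  proof (induction n)
    case 0
    show ?case using assms(1) by (auto simp: iwp_eq_iff)
  next
    case (Suc n)
    \<comment> \<open>Equivalence determines integrands only at finite witnesses; the total
      \<open>g \<sigma>\<close> bounds every partial sum and provides this finiteness.\<close>
    have "witness (F (Suc n)) \<sigma> \<le> g \<sigma>"
      unfolding wF g_def by (intro sum_le_suminf) auto
    with that have "witness (F (Suc n)) \<sigma> \<noteq> \<infinity>"
      by (auto simp: top_unique)
    with Suc show ?case using assms(2)[of n] by (auto simp: iwp_eq_iff)
  qed
  have dom: "(\<Sum>k. ennreal \<bar>integrand (D k) \<sigma>\<bar>) \<le> g \<sigma>" for \<sigma>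
    unfolding g_def by (intro suminf_le abs_integrand_le_witness) auto
  have summable: "summable (\<lambda>k. \<bar>integrand (D k) \<sigma>\<bar>)" if "g \<sigma> \<noteq> \<infinity>" for \<sigma>
    using dom[of \<sigma>] that by (intro summable_suminf_not_top) (auto simp: top_unique)
  have "ennreal \<bar>f \<sigma>\<bar> \<le> g \<sigma>" for \<sigma>
  proof (cases "g \<sigma> = \<infinity>")
    case False
    have "ennreal \<bar>f \<sigma>\<bar> \<le> ennreal (\<Sum>k. \<bar>integrand (D k) \<sigma>\<bar>)"
      using False summable_rabs[OF summable[OF False]] by (simp add: f_def ennreal_leI)
    also have "\<dots> = (\<Sum>k. ennreal \<bar>integrand (D k) \<sigma>\<bar>)"
      using summable[OF False] by (intro suminf_ennreal2[symmetric]) auto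
    finally show ?thesis using dom[of \<sigma>] by simp
  qed simp
  then obtain L where L: "integrand L = f" "witness L = g"
    by (rule iwp_exists)
  have "(\<lambda>n. witness (F n) \<sigma>) \<longlonglongrightarrow> g \<sigma>" for \<sigma>
    unfolding wF g_def by (intro summable_LIMSEQ) auto
  moreover have "(\<lambda>n. integrand (F n) \<sigma>) \<longlonglongrightarrow> f \<sigma>" if "g \<sigma> \<noteq> \<infinity>" for \<sigma>
    using that summable_LIMSEQ[OF summable_rabs_cancel[OF summable[OF that]]]
    by (simp add: iF f_def)
  ultimately have "iwp_tendsto F L"
    by (simp add: iwp_tendsto_def L)
  then show ?thesis ..
qed

lemma ie_series_tendsto:
  assumes "S 0 = 0" and "\<And>n. S (Suc n) = S n + D n"
  shows "\<exists>L. ie_tendsto S L"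
  using assms by transfer (rule iwp_series_tendsto)

text \<open>The increments are \<open>(T ^^ n) A\<close>: \<open>T 0 = 0\<close> gives the first
  one, and additivity of \<open>T\<close> carries each to the next.\<close>

lemma ie_affine_iterates_tendsto:
  fixes T :: "'s ie \<Rightarrow> 's ie"
  assumes zero: "T 0 = 0" and add: "\<And>X Y. T (X + Y) = T X + T Y"
  shows "\<exists>L. ie_tendsto (\<lambda>n. ((\<lambda>Y. A + T Y) ^^ n) 0) L"
proof (rule ie_series_tendsto)
  show "((\<lambda>Y. A + T Y) ^^ Suc n) 0 = ((\<lambda>Y. A + T Y) ^^ n) 0 + (T ^^ n) A" for n
  proof (induction n)
    case (Suc n)
    let ?\<Psi> = "\<lambda>Y. A + T Y"
    have "(?\<Psi> ^^ Suc (Suc n)) 0 = A + T ((?\<Psi> ^^ n) 0 + (T ^^ n) A)"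
      using Suc by simp
    also have "\<dots> = (?\<Psi> ^^ Suc n) 0 + (T ^^ Suc n) A"
      by (simp add: add add.assoc)
    finally show ?case .
  qed (simp add: zero)
qed simp

definition wp_iterate ::
  "('v, 'a) state guard \<Rightarrow> ('v, 'a) prog \<Rightarrow> ('v, 'a) state ie \<Rightarrow> nat \<Rightarrow> ('v, 'a) state ie" where
  "wp_iterate \<xi> C X n = ((\<lambda>Y. (\<lambda>\<sigma>. 1 - prob \<xi> \<sigma>) \<odot> X + prob \<xi> \<odot> wp C Y) ^^ n) 0"

lemma wp_iterate_simps [simp]:
  "wp_iterate \<xi> C X 0 = 0"
  "wp_iterate \<xi> C X (Suc n) = (\<lambda>\<sigma>. 1 - prob \<xi> \<sigma>) \<odot> X + prob \<xi> \<odot> wp C (wp_iterate \<xi> C X n)"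
  by (simp_all add: wp_iterate_def)

lemma wp_While: "wp (While \<xi> C) X = ie_lim (wp_iterate \<xi> C X)"
  by (simp add: wp_iterate_def[abs_def])

text \<open>The assumptions on the body are what the induction hypothesis of
  \<open>wp_zero_add\<close> supplies; \<open>wp_While_tendsto\<close> discharges them
  afterwards.\<close>

lemma wp_While_tendsto_aux:
  assumes "wp C 0 = 0" and "\<And>X Y. wp C (X + Y) = wp C X + wp C Y"
  shows "ie_tendsto (wp_iterate \<xi> C X) (wp (While \<xi> C) X)"
proof -
  have "\<exists>L. ie_tendsto (wp_iterate \<xi> C X) L"
    unfolding wp_iterate_def[abs_def]
    by (rule ie_affine_iterates_tendsto) (simp_all add: assms scale_ie_add scale_ie_zero)
  then show ?thesis
    unfolding wp_While using ie_lim_eq by metis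
qed

text \<open>Both claims go through one induction, since the limit of a loop is obtained from both
  for its body. Additivity alone would only force each witness value of \<open>wp C 0\<close> to be
  0 or infinite.\<close>

lemma wp_zero_add: "wp C 0 = 0 \<and> (\<forall>X Y. wp C (X + Y) = wp C X + wp C Y)"
proof (induction C)
  case (While \<xi> C)
  then have zero: "wp C 0 = 0" and add: "\<And>X Y. wp C (X + Y) = wp C X + wp C Y"
    by auto
  note lim = wp_While_tendsto_aux[OF zero add, of \<xi>]
  have "wp_iterate \<xi> C 0 n = 0" for n
    by (induction n) (simp_all add: zero scale_ie_zero)
  with lim[of 0] have "wp (While \<xi> C) 0 = 0"
    using ie_tendsto_unique[OF _ ie_tendsto_const] by (metis ext)
  moreover have "wp (While \<xi> C) (X + Y) = wp (While \<xi> C) X + wp (While \<xi> C) Y" for X Y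
  proof -
    \<comment> \<open>Additivity holds for each iterate, hence for the limits by their
      uniqueness.\<close>
    have "wp_iterate \<xi> C (X + Y) n = wp_iterate \<xi> C X n + wp_iterate \<xi> C Y n" for n
      by (induction n) (simp_all add: add scale_ie_add ac_simps)
    then show ?thesis
      using ie_tendsto_unique[OF lim[of "X + Y"]] ie_tendsto_add[OF lim[of X] lim[of Y]]
      by presburger
  qed
  ultimately show ?case by blast
qed (simp_all add: subst_ie_zero subst_ie_add scale_ie_zero scale_ie_add ac_simps)

lemma wp_While_tendsto: "ie_tendsto (wp_iterate \<xi> C X) (wp (While \<xi> C) X)"
  using wp_zero_add[of C] by (intro wp_While_tendsto_aux) auto

lemma prob_bounds: "0 \<le> prob \<xi> \<sigma>" "prob \<xi> \<sigma> \<le> 1"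
  using prob[of \<xi>] by auto

theorem theorem4:
  fixes C :: "('v, 'a) prog" and X X' :: "('v, 'a) state ie"
  assumes "X \<le> X'"
  shows "wp C X \<le> wp C X'"
  using assms
proof (induction C arbitrary: X X')
  case (While \<xi> C)
  \<comment> \<open>The hypothesis on the body is applied to the two \<open>n\<close>-th iterates
    instead of \<open>X\<close> and \<open>X'\<close>, which is why the induction generalises over
    both.\<close>
  have "wp_iterate \<xi> C X n \<le> wp_iterate \<xi> C X' n" for n
    by (induction n) (auto intro!: ie_add_mono scale_ie_mono While simp: prob_bounds)
  then show ?case
    by (rule ie_tendsto_le[OF wp_While_tendsto wp_While_tendsto])
qed (auto intro!: ie_add_mono scale_ie_mono subst_ie_mono simp: prob_bounds)

end
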